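(* For all integers $n\geq 0$, the Fibonacci-Fubini number $\mathcal{F}_n$ satisfies the Dobiński-like formula $$\mathcal{F}_n=\frac{1}{\sqrt{5}}\left(\frac{\alpha}{e^{\alpha}}\sum_{k\geq 0} \frac{\alpha^k k^n}{k!}-\frac{\beta}{e^{\beta}}\sum_{k\geq 0} \frac{\beta^k k^n}{k!}\right).$$
   Context: $\alpha=(1+\sqrt5)/2$ and $\beta=(1-\sqrt5)/2$. Convention: $0^0=1$. A permutation $\sigma=\sigma_1\cdots\sigma_k$ of $\{1,\dots,k\}$ is a Fibonacci permutation if $|\sigma_i-i|\le 1$ for every $i$. For a set partition of $[n]=\{1,\dots,n\}$ into non-empty blocks $B_1|B_2|\cdots|B_k$, the blocks are always listed so that $\min B_1<\min B_2<\cdots<\min B_k$. A Fibonacci ordered partition of $[n]$ is an arrangement $B_{\sigma_1}|B_{\sigma_2}|\cdots|B_{\sigma_k}$ where $B_1|\cdots|B_k$ is a partition of $[n]$ (any number $k$ of blocks) and $\sigma$ is a Fibonacci permutation of $\{1,\dots,k\}$. The Fibonacci-Fubini number $\mathcal{F}_n$ is the total number of Fibonacci ordered partitions of $[n]$ (for $n=0$ the empty partition with $k=0$ blocks is counted once, so $\mathcal{F}_0=1$). *)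

theory Defs
  imports "HOL-Analysis.Analysis" "HOL-Library.Disjoint_Sets" "HOL-Combinatorics.Permutations"
begin

definition fib_alpha :: real where
  "fib_alpha = (1 + sqrt 5) / 2"

definition fib_beta :: real where
  "fib_beta = (1 - sqrt 5) / 2"

(* Positions and block indices run over {0..<k} instead of {1..k}, matching the indexing of lists;
   the condition on the displacement is invariant under this shift. *)
definition fibonacci_permutation :: "nat \<Rightarrow> (nat \<Rightarrow> nat) \<Rightarrow> bool" where
  "fibonacci_permutation k \<sigma> \<longleftrightarrow>
     \<sigma> permutes {..<k} \<and> (\<forall>i<k. \<bar>int (\<sigma> i) - int i\<bar> \<le> 1)"

(* Every partition of {1..n} has exactly one such listing: the list of its blocks in the order of
   increasing minima. *)
definition partition_listing :: "nat \<Rightarrow> nat set list \<Rightarrow> bool" where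
  "partition_listing n Bs \<longleftrightarrow>
     partition_on {1..n} (set Bs) \<and> sorted_wrt (\<lambda>A B. Min A < Min B) Bs"

(* The i-th entry of permute_list \<sigma> Bs is Bs ! \<sigma> i. *)
definition fibonacci_ordered_partitions :: "nat \<Rightarrow> nat set list set" where
  "fibonacci_ordered_partitions n =
     {permute_list \<sigma> Bs | \<sigma> Bs. partition_listing n Bs \<and> fibonacci_permutation (length Bs) \<sigma>}"

definition fibonacci_fubini :: "nat \<Rightarrow> nat" where
  "fibonacci_fubini n = card (fibonacci_ordered_partitions n)"

(* The Dobinski-type series converge, so suminf denotes their actual sums. *)
lemma summable_dobinski:
  fixes x :: real
  shows "summable (\<lambda>k. x ^ k * real k ^ n / fact k)"
proof (rule summable_comparison_test')
  show "summable (\<lambda>k. fact n * (inverse (fact k) * (\<bar>x\<bar> * exp 1) ^ k))"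
    by (intro summable_mult summable_exp)
next
  fix k :: nat
  have "real k ^ n / fact n \<le> (\<Sum>i\<in>{n}. real k ^ i /\<^sub>R fact i)"
    by (simp add: field_simps)
  also have "\<dots> \<le> exp (real k)"
    unfolding exp_def by (rule sum_le_suminf) (auto intro: summable_exp)
  also have "exp (real k) = exp 1 ^ k"
    by (simp flip: exp_of_nat_mult)
  finally have "real k ^ n \<le> fact n * exp 1 ^ k"
    by (simp add: field_simps)
  then have "\<bar>x\<bar> ^ k * real k ^ n / fact k \<le> \<bar>x\<bar> ^ k * (fact n * exp 1 ^ k) / fact k"
    by (intro divide_right_mono mult_left_mono) auto
  then show "norm (x ^ k * real k ^ n / fact k) \<le> fact n * (inverse (fact k) * (\<bar>x\<bar> * exp 1) ^ k)"
    by (simp add: abs_mult power_abs power_mult_distrib field_simps)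
qed

end

theory Submission
  imports Defs "HOL-Combinatorics.Stirling" "HOL-Number_Theory.Fib"
begin

text \<open>
  A Fibonacci ordered partition determines both its partition and its permutation, so there are
  \<open>S(n,k) F(k+1)\<close> of them with \<open>k\<close> blocks, where \<open>S\<close> are the Stirling numbers of the second kind and
  \<open>F\<close> the Fibonacci numbers. Expanding \<open>k\<^sup>n\<close> in falling factorials evaluates the series in
  \<open>x\<close> to \<open>exp x\<close> times the Touchard polynomial \<open>\<Sum>\<^sub>j S(n,j) x\<^sup>j\<close>; taking \<open>x = \<alpha>\<close> and
  \<open>x = \<beta>\<close>, Binet's formula turns the difference into the same sum.
\<close>

section \<open>Listings of set partitions\<close>

text \<open>Strictly increasing minima force distinct positions to hold distinct blocks, so
  disjointness of the blocks as a set can be stated position by position. In this form the property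
  splits along \<open>@\<close>.\<close>

lemma partition_listing_iff:
  "partition_listing n Bs \<longleftrightarrow>
     {} \<notin> set Bs \<and> \<Union>(set Bs) = {1..n} \<and> sorted_wrt (\<lambda>A B. disjnt A B \<and> Min A < Min B) Bs"
proof
  assume l: "partition_listing n Bs"
  have "disjnt (Bs ! i) (Bs ! j) \<and> Min (Bs ! i) < Min (Bs ! j)" if "i < j" "j < length Bs" for i j
  proof -
    have less: "Min (Bs ! i) < Min (Bs ! j)"
      using l that by (simp add: partition_listing_def sorted_wrt_iff_nth_less)
    then have "Bs ! i \<noteq> Bs ! j"
      by auto
    moreover have "Bs ! i \<in> set Bs" "Bs ! j \<in> set Bs"
      using that by auto
    ultimately have "disjnt (Bs ! i) (Bs ! j)"
      using l by (auto simp: partition_listing_def partition_on_def dest: pairwiseD)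
    with less show ?thesis
      by simp
  qed
  then show "{} \<notin> set Bs \<and> \<Union>(set Bs) = {1..n} \<and>
      sorted_wrt (\<lambda>A B. disjnt A B \<and> Min A < Min B) Bs"
    using l by (simp add: partition_listing_def partition_on_def sorted_wrt_iff_nth_less)
next
  assume r: "{} \<notin> set Bs \<and> \<Union>(set Bs) = {1..n} \<and>
      sorted_wrt (\<lambda>A B. disjnt A B \<and> Min A < Min B) Bs"
  have "disjnt A B" if AB: "A \<in> set Bs" "B \<in> set Bs" "A \<noteq> B" for A B
  proof -
    obtain i j where ij: "i < length Bs" "A = Bs ! i" "j < length Bs" "B = Bs ! j"
      using AB by (metis in_set_conv_nth)
    then have "i < j \<or> j < i"
      using AB(3) nat_neq_iff by blast
    then show ?thesis
      using r ij by (auto simp: sorted_wrt_iff_nth_less disjnt_sym)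
  qed
  then show "partition_listing n Bs"
    using r
    by (auto simp: partition_listing_def partition_on_def pairwise_def sorted_wrt_iff_nth_less)
qed

lemma partition_listing_nth_subset:
  "partition_listing n Bs \<Longrightarrow> i < length Bs \<Longrightarrow> Bs ! i \<subseteq> {1..n}"
  unfolding partition_listing_iff by (metis Union_upper nth_mem)

lemma partition_listing_nth_finite:
  "partition_listing n Bs \<Longrightarrow> i < length Bs \<Longrightarrow> finite (Bs ! i)"
  by (rule finite_subset[OF partition_listing_nth_subset]) auto

lemma partition_listing_nth_nonempty:
  "partition_listing n Bs \<Longrightarrow> i < length Bs \<Longrightarrow> Bs ! i \<noteq> {}"
  unfolding partition_listing_iff by (metis nth_mem)

lemma partition_listing_nth_less:
  "partition_listing n Bs \<Longrightarrow> i < j \<Longrightarrow> j < length Bs \<Longrightarrow>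
     disjnt (Bs ! i) (Bs ! j) \<and> Min (Bs ! i) < Min (Bs ! j)"
  by (simp add: partition_listing_iff sorted_wrt_iff_nth_less)

lemma partition_listing_nth_disjnt:
  "partition_listing n Bs \<Longrightarrow> i < length Bs \<Longrightarrow> j < length Bs \<Longrightarrow> i \<noteq> j \<Longrightarrow>
     disjnt (Bs ! i) (Bs ! j)"
  by (metis disjnt_sym linorder_neqE_nat partition_listing_nth_less)

lemma partition_listingI:
  assumes "\<And>i. i < length Bs \<Longrightarrow> Bs ! i \<noteq> {}" "(\<Union>i<length Bs. Bs ! i) = {1..n}"
    "\<And>i j. i < j \<Longrightarrow> j < length Bs \<Longrightarrow> disjnt (Bs ! i) (Bs ! j) \<and> Min (Bs ! i) < Min (Bs ! j)"
  shows "partition_listing n Bs"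
proof -
  have "{} \<notin> set Bs"
    using assms(1) by (metis in_set_conv_nth)
  moreover have "set Bs = (!) Bs ` {..<length Bs}"
    by (auto simp: in_set_conv_nth)
  ultimately show ?thesis
    using assms(2,3) by (simp add: partition_listing_iff sorted_wrt_iff_nth_less)
qed

lemma partition_listing_Union:
  assumes "partition_listing n Bs"
  shows "(\<Union>i<length Bs. Bs ! i) = {1..n}"
proof -
  have "set Bs = (!) Bs ` {..<length Bs}"
    by (auto simp: in_set_conv_nth)
  then show ?thesis
    using assms by (simp add: partition_listing_iff)
qed

lemma partition_listing_distinct: "partition_listing n Bs \<Longrightarrow> distinct Bs"
  unfolding distinct_conv_nth
  by (metis disjnt_self_iff_empty partition_listing_nth_disjnt partition_listing_nth_nonempty)

text \<open>\<open>Min\<close> is injective on the blocks and both lists are sorted by it, so the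
  set of blocks fixes their order.\<close>

lemma partition_listing_unique:
  assumes "partition_listing n Bs" "partition_listing n Cs" "set Bs = set Cs"
  shows "Bs = Cs"
proof (rule map_sorted_distinct_set_unique)
  have *: "sorted_wrt (<) (map Min Ds)" if "partition_listing n Ds" for Ds
    using that by (simp add: partition_listing_def sorted_wrt_map)
  show "sorted (map Min Bs)" "distinct (map Min Bs)" "sorted (map Min Cs)" "distinct (map Min Cs)"
    using *[OF assms(1)] *[OF assms(2)] by (simp_all add: strict_sorted_iff)
  then show "inj_on Min (set Bs \<union> set Cs)"
    using assms(3) by (simp add: distinct_map)
  show "set Bs = set Cs"
    by fact
qed

section \<open>Adding and removing the largest element\<close>

lemma partition_listing_append_singleton_iff:
  "partition_listing (Suc n) (Bs @ [{Suc n}]) \<longleftrightarrow> partition_listing n Bs"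
proof -
  \<comment> \<open>A non-empty block inside \<open>{1..n}\<close> has minimum at most
    \<open>n\<close>, so what the append demands of the last block is automatic once the earlier
    blocks cover \<open>{1..n}\<close>. Conversely, disjointness from \<open>{Suc n}\<close> gives
    back this union.\<close>
  have *: "\<Union>(set Bs) \<union> {Suc n} = {1..Suc n} \<and> (\<forall>B\<in>set Bs. disjnt B {Suc n} \<and> Min B < Suc n) \<longleftrightarrow>
      \<Union>(set Bs) = {1..n}" (is "?L \<longleftrightarrow> ?R") if ne: "{} \<notin> set Bs"
  proof
    assume ?L
    then have "\<Union>(set Bs) = {1..Suc n} - {Suc n}"
      by (auto simp: disjnt_def)
    also have "\<dots> = {1..n}"
      by auto
    finally show ?R .
  next
    assume R: ?R
    have "disjnt B {Suc n} \<and> Min B < Suc n" if "B \<in> set Bs" for B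
    proof -
      have "B \<subseteq> {1..n}" "B \<noteq> {}"
        using R ne that by auto
      moreover from this have "Min B \<in> B"
        using finite_subset by (intro Min_in) auto
      ultimately show ?thesis
        by (auto simp: disjnt_def)
    qed
    with R show ?L
      by (auto simp: disjnt_def)
  qed
  show ?thesis
    unfolding partition_listing_iff using * by (auto simp: sorted_wrt_append)
qed

definition insert_at :: "'a \<Rightarrow> nat \<Rightarrow> 'a set list \<Rightarrow> 'a set list" where
  "insert_at x i Bs = Bs[i := insert x (Bs ! i)]"

lemma length_insert_at [simp]: "length (insert_at x i Bs) = length Bs"
  by (simp add: insert_at_def)

lemma nth_insert_at:
  "j < length Bs \<Longrightarrow> insert_at x i Bs ! j = (if j = i then insert x (Bs ! i) else Bs ! j)"
  by (auto simp: insert_at_def nth_list_update)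

lemma Min_insert_absorb:
  fixes x :: "'a::linorder"
  assumes "finite A" "A \<noteq> {}" "Min A \<le> x"
  shows "Min (insert x A) = Min A"
  using assms by (intro Min_eqI) auto

text \<open>\<open>Suc n\<close> exceeds all elements present, so adding it to a non-empty block
  changes no minimum and the order of the blocks survives.\<close>

lemma partition_listing_insert_at:
  assumes l: "partition_listing n Bs" and i: "i < length Bs"
  shows "partition_listing (Suc n) (insert_at (Suc n) i Bs)"
proof (rule partition_listingI; simp)
  let ?Cs = "insert_at (Suc n) i Bs"
  show "?Cs ! j \<noteq> {}" if "j < length Bs" for j
    using that partition_listing_nth_nonempty[OF l] by (auto simp: nth_insert_at)
  have "(\<Union>j<length Bs. ?Cs ! j) = insert (Suc n) (\<Union>j<length Bs. Bs ! j)"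
    using i by (auto simp: nth_insert_at split: if_splits)
  also have "\<dots> = {Suc 0..Suc n}"
    using partition_listing_Union[OF l] by auto
  finally show "(\<Union>j<length Bs. ?Cs ! j) = {Suc 0..Suc n}" .
  fix a b assume ab: "a < b" "b < length Bs"
  have Min: "Min (?Cs ! j) = Min (Bs ! j)" if j: "j < length Bs" for j
  proof -
    have fin: "finite (Bs ! j)" "Bs ! j \<noteq> {}" "Bs ! j \<subseteq> {1..n}"
      using partition_listing_nth_finite partition_listing_nth_nonempty
        partition_listing_nth_subset l j by blast+
    then have "Min (Bs ! j) \<le> Suc n"
      using Min_in by fastforce
    then have "Min (insert (Suc n) (Bs ! j)) = Min (Bs ! j)"
      by (rule Min_insert_absorb[OF fin(1,2)])
    with j show ?thesis
      by (auto simp: nth_insert_at)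
  qed
  have "Suc n \<notin> Bs ! a" "Suc n \<notin> Bs ! b"
    using partition_listing_nth_subset[OF l, of a] partition_listing_nth_subset[OF l, of b] ab by auto
  then show "disjnt (?Cs ! a) (?Cs ! b) \<and> Min (?Cs ! a) < Min (?Cs ! b)"
    using partition_listing_nth_less[OF l ab] ab Min[of a] Min[of b] by (auto simp: nth_insert_at)
qed

text \<open>This inverts \<open>insert_at\<close>. A block equal to \<open>{Suc n}\<close> is
  excluded because deletion would leave it empty; otherwise the block keeps its minimum.\<close>

lemma partition_listing_remove:
  assumes l: "partition_listing (Suc n) Cs" and i: "i < length Cs"
    and mem: "Suc n \<in> Cs ! i" and ne: "Cs ! i \<noteq> {Suc n}"
  defines "Bs \<equiv> Cs[i := Cs ! i - {Suc n}]"
  shows "partition_listing n Bs" and "insert_at (Suc n) i Bs = Cs"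
proof -
  \<comment> \<open>By disjointness only block \<open>i\<close> contains \<open>Suc n\<close>, so
    the update at one position is the same as deleting \<open>Suc n\<close> from every
    block.\<close>
  have nth: "Bs ! j = Cs ! j - {Suc n}" if "j < length Cs" for j
    using that i mem partition_listing_nth_disjnt[OF l i that]
    by (auto simp: Bs_def nth_list_update disjnt_def)
  have len: "length Bs = length Cs"
    by (simp add: Bs_def)
  show "insert_at (Suc n) i Bs = Cs"
    using i mem by (auto simp: insert_at_def Bs_def insert_absorb)
  have nonempty: "Bs ! j \<noteq> {}" if "j < length Cs" for j
    using that ne mem partition_listing_nth_nonempty[OF l that] nth i
    by (cases "j = i") (auto simp: Bs_def)
  have Min: "Min (Bs ! j) = Min (Cs ! j)" if j: "j < length Cs" for j
  proof (cases "Suc n \<in> Cs ! j")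
    case True
    have sub: "Cs ! j \<subseteq> {1..Suc n}"
      by (rule partition_listing_nth_subset[OF l j])
    have fin: "finite (Bs ! j)"
      using partition_listing_nth_finite[OF l j] by (simp add: nth j)
    moreover from this have "Min (Bs ! j) \<le> Suc n"
      using Min_in[OF fin nonempty[OF j]] sub nth[OF j] by fastforce
    moreover have "Cs ! j = insert (Suc n) (Bs ! j)"
      using True nth j by auto
    ultimately show ?thesis
      using Min_insert_absorb nonempty[OF j] by metis
  next
    case False
    then show ?thesis
      using nth j by simp
  qed
  show "partition_listing n Bs"
  proof (rule partition_listingI; simp only: len)
    show "Bs ! j \<noteq> {}" if "j < length Cs" for j
      using nonempty that .
    have "(\<Union>j<length Cs. Bs ! j) = (\<Union>j<length Cs. Cs ! j) - {Suc n}"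
      using nth by auto
    also have "\<dots> = {1..n}"
      using partition_listing_Union[OF l] by auto
    finally show "(\<Union>j<length Cs. Bs ! j) = {1..n}" .
    fix a b assume "a < b" "b < length Cs"
    then show "disjnt (Bs ! a) (Bs ! b) \<and> Min (Bs ! a) < Min (Bs ! b)"
      using partition_listing_nth_less[OF l] Min by (auto simp: nth disjnt_def)
  qed
qed

text \<open>A block after \<open>{Suc n}\<close> would need a minimum above \<open>Suc n\<close>,
  outside the ground set.\<close>

lemma partition_listing_singleton_last:
  assumes l: "partition_listing (Suc n) Cs" and i: "i < length Cs" and eq: "Cs ! i = {Suc n}"
  shows "Cs = butlast Cs @ [{Suc n}]"
proof -
  have "i = length Cs - 1"
  proof (rule ccontr)
    assume "i \<noteq> length Cs - 1"
    with i have j: "i < Suc i" "Suc i < length Cs"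
      by auto
    have "Suc n < Min (Cs ! Suc i)"
      using partition_listing_nth_less[OF l j] eq by simp
    moreover have "Min (Cs ! Suc i) \<in> Cs ! Suc i"
      using partition_listing_nth_finite[OF l j(2)] partition_listing_nth_nonempty[OF l j(2)] by simp
    ultimately show False
      using partition_listing_nth_subset[OF l j(2)] by fastforce
  qed
  moreover have "Cs \<noteq> []"
    using i by auto
  ultimately have "last Cs = {Suc n}"
    using eq by (metis last_conv_nth)
  then show ?thesis
    using append_butlast_last_id[OF \<open>Cs \<noteq> []\<close>] by simp
qed

section \<open>Counting listings by number of blocks\<close>

definition partition_listings :: "nat \<Rightarrow> nat \<Rightarrow> nat set list set" where
  "partition_listings n k = {Bs. partition_listing n Bs \<and> length Bs = k}"

lemma partition_listings_0: "partition_listings 0 k = (if k = 0 then {[]} else {})"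
proof -
  have "partition_listing 0 Bs \<longleftrightarrow> Bs = []" for Bs
    by (cases Bs) (auto simp: partition_listing_iff)
  then show ?thesis
    by (auto simp: partition_listings_def)
qed

lemma partition_listings_Suc_0: "partition_listings (Suc n) 0 = {}"
  by (auto simp: partition_listings_def partition_listing_iff)

text \<open>Appending the new maximum as a singleton block, or inserting it into any block, keeps the
  order of the minima; this is the recurrence of the Stirling numbers.\<close>

lemma partition_listings_Suc_Suc:
  "partition_listings (Suc n) (Suc k) =
     (\<lambda>Bs. Bs @ [{Suc n}]) ` partition_listings n k \<union>
     (\<lambda>(i, Bs). insert_at (Suc n) i Bs) ` ({..<Suc k} \<times> partition_listings n (Suc k))"
  (is "?L = ?A \<union> ?B")
proof
  show "?A \<union> ?B \<subseteq> ?L"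
    by (auto simp: partition_listings_def partition_listing_append_singleton_iff
        partition_listing_insert_at)
  show "?L \<subseteq> ?A \<union> ?B"
  proof
    fix Cs assume "Cs \<in> ?L"
    then have l: "partition_listing (Suc n) Cs" and len: "length Cs = Suc k"
      by (auto simp: partition_listings_def)
    have "Suc n \<in> (\<Union>i<length Cs. Cs ! i)"
      using partition_listing_Union[OF l] by simp
    then obtain i where i: "i < length Cs" "Suc n \<in> Cs ! i"
      by auto
    show "Cs \<in> ?A \<union> ?B"
    proof (cases "Cs ! i = {Suc n}")
      case True
      have Cs: "Cs = butlast Cs @ [{Suc n}]"
        using partition_listing_singleton_last[OF l i(1) True] .
      then have "partition_listing n (butlast Cs)"
        using l partition_listing_append_singleton_iff by metis
      then have "butlast Cs \<in> partition_listings n k"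
        by (simp add: partition_listings_def len)
      then show ?thesis
        using Cs by blast
    next
      case False
      define Bs where "Bs = Cs[i := Cs ! i - {Suc n}]"
      have "partition_listing n Bs" "insert_at (Suc n) i Bs = Cs"
        unfolding Bs_def by (rule partition_listing_remove[OF l i False])+
      moreover have "length Bs = Suc k"
        by (simp add: Bs_def len)
      ultimately have "(i, Bs) \<in> {..<Suc k} \<times> partition_listings n (Suc k)"
        using i(1) len by (simp add: partition_listings_def)
      then show ?thesis
        using \<open>insert_at (Suc n) i Bs = Cs\<close> by force
    qed
  qed
qed

text \<open>The new element marks its own position: \<open>i\<close> is the only index whose block
  contains \<open>Suc n\<close>, and deleting it there recovers \<open>Bs\<close>.\<close>

lemma inj_on_insert_at:
  "inj_on (\<lambda>(i, Bs). insert_at (Suc n) i Bs) ({..<k} \<times> partition_listings n k)"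
proof (rule inj_onI; clarsimp)
  fix i j Bs Cs
  assume "i < k" "j < k" "Bs \<in> partition_listings n k" "Cs \<in> partition_listings n k"
    and eq: "insert_at (Suc n) i Bs = insert_at (Suc n) j Cs"
  then have k: "i < length Cs" "j < length Cs" "length Bs = length Cs"
    and l: "partition_listing n Bs" "partition_listing n Cs"
    by (auto simp: partition_listings_def)
  have nth: "(if m = i then insert (Suc n) (Bs ! i) else Bs ! m) =
      (if m = j then insert (Suc n) (Cs ! j) else Cs ! m)" if "m < length Cs" for m
    using eq that k by (metis nth_insert_at)
  have notin: "Suc n \<notin> Bs ! m" "Suc n \<notin> Cs ! m" if "m < length Cs" for m
    using partition_listing_nth_subset[OF l(1), of m] partition_listing_nth_subset[OF l(2), of m]
      that k by auto
  have ij: "i = j"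
    using nth[OF k(1)] notin(2)[OF k(1)] by (auto split: if_splits)
  moreover have "Bs = Cs"
  proof (rule nth_equalityI)
    show "Bs ! m = Cs ! m" if "m < length Bs" for m
      using nth[of m] notin[of m] that k ij by (auto split: if_splits dest: insert_ident[THEN iffD1])
  qed fact
  ultimately show "i = j \<and> Bs = Cs"
    by blast
qed

lemma card_partition_listings:
  "finite (partition_listings n k) \<and> card (partition_listings n k) = Stirling n k"
proof (induction n arbitrary: k)
  case 0
  then show ?case
    by (cases k) (simp_all add: partition_listings_0)
next
  case (Suc n)
  show ?case
  proof (cases k)
    case 0
    then show ?thesis
      by (simp add: partition_listings_Suc_0)
  next
    case (Suc k')
    let ?A = "(\<lambda>Bs. Bs @ [{Suc n}]) ` partition_listings n k'"
    let ?B = "(\<lambda>(i, Bs). insert_at (Suc n) i Bs) ` ({..<Suc k'} \<times> partition_listings n (Suc k'))"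
    \<comment> \<open>The two kinds of extension are told apart by whether \<open>{Suc n}\<close> is
      a block. After an insertion it is not, since the enlarged block still contains an element of
      \<open>{1..n}\<close>.\<close>
    have "{Suc n} \<notin> set Cs" if "Cs \<in> ?B" for Cs
    proof
      assume "{Suc n} \<in> set Cs"
      then obtain j where j: "j < length Cs" "Cs ! j = {Suc n}"
        by (metis in_set_conv_nth)
      from that obtain i Bs where "Cs = insert_at (Suc n) i Bs" "Bs \<in> partition_listings n (Suc k')"
        by (auto elim!: imageE)
      then have Bs: "Cs = insert_at (Suc n) i Bs" "partition_listing n Bs"
        by (simp_all add: partition_listings_def)
      then have "Bs ! j \<subseteq> {Suc n}"
        using j by (auto simp: nth_insert_at split: if_splits)
      moreover have "Bs ! j \<subseteq> {1..n}" "Bs ! j \<noteq> {}"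
        using partition_listing_nth_subset[OF Bs(2)] partition_listing_nth_nonempty[OF Bs(2)] j Bs(1)
        by auto
      then obtain x where "x \<in> Bs ! j" "x \<in> {1..n}"
        by blast
      ultimately show False
        by auto
    qed
    moreover have "{Suc n} \<in> set Cs" if "Cs \<in> ?A" for Cs
      using that by auto
    ultimately have disj: "?A \<inter> ?B = {}"
      by blast
    have "card ?A = Stirling n k'"
      using Suc.IH by (simp add: card_image inj_on_def)
    moreover have "card ?B = Suc k' * Stirling n (Suc k')"
      using Suc.IH by (simp only: card_image[OF inj_on_insert_at]) (simp add: card_cartesian_product)
    moreover have "finite ?A" "finite ?B"
      using Suc.IH by simp_all
    ultimately show ?thesis
      unfolding Suc partition_listings_Suc_Suc by (simp add: card_Un_disjoint[OF _ _ disj])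
  qed
qed

section \<open>Fibonacci permutations\<close>

text \<open>\<open>permutes\<close> makes a function the identity outside its set, so a permutation
  that fixes the last position is literally the same function as one on the shorter range.\<close>

lemma fibonacci_permutation_Suc_fix_iff:
  "fibonacci_permutation (Suc k) \<sigma> \<and> \<sigma> k = k \<longleftrightarrow> fibonacci_permutation k \<sigma>"
proof -
  have "\<sigma> permutes {..<Suc k} \<and> \<sigma> k = k \<longleftrightarrow> \<sigma> permutes {..<k}"
  proof
    assume *: "\<sigma> permutes {..<Suc k} \<and> \<sigma> k = k"
    then have "\<sigma> x = x" if "x \<in> {..<Suc k} - {..<k}" for x
      using that by (metis Diff_iff lessThan_iff less_Suc_eq)
    with * show "\<sigma> permutes {..<k}"
      by (blast intro: permutes_superset)
  next
    assume *: "\<sigma> permutes {..<k}"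
    then have "\<sigma> k = k"
      by (rule permutes_not_in) simp
    with * show "\<sigma> permutes {..<Suc k} \<and> \<sigma> k = k"
      using permutes_subset[of \<sigma> "{..<k}" "{..<Suc k}"] by auto
  qed
  then show ?thesis
    by (auto simp: fibonacci_permutation_def less_Suc_eq)
qed

text \<open>If the last position is moved, its value is the one before, and then surjectivity forces the
  last two positions to be swapped.\<close>

lemma fibonacci_permutation_Suc_Suc_swap:
  "{\<sigma>. fibonacci_permutation (Suc (Suc k)) \<sigma> \<and> \<sigma> (Suc k) \<noteq> Suc k} =
     (\<lambda>\<tau>. \<tau> \<circ> Transposition.transpose k (Suc k)) ` {\<tau>. fibonacci_permutation k \<tau>}" (is "?L = ?R")
proof
  show "?R \<subseteq> ?L"
  proof clarify
    fix \<tau> assume \<tau>: "fibonacci_permutation k \<tau>"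
    then have perm: "\<tau> permutes {..<k}"
      by (simp add: fibonacci_permutation_def)
    then have fixed: "\<tau> k = k" "\<tau> (Suc k) = Suc k"
      by (auto intro: permutes_not_in)
    have "\<tau> \<circ> Transposition.transpose k (Suc k) permutes {..<Suc (Suc k)}"
      by (intro permutes_compose permutes_swap_id permutes_subset[OF perm]) auto
    moreover have "\<bar>int ((\<tau> \<circ> Transposition.transpose k (Suc k)) i) - int i\<bar> \<le> 1"
      if i: "i < Suc (Suc k)" for i
    proof -
      consider "i < k" | "i = k" | "i = Suc k"
        using i by linarith
      then show ?thesis
        using \<tau> fixed by (cases; auto simp: fibonacci_permutation_def Transposition.transpose_def)
    qed
    ultimately show "fibonacci_permutation (Suc (Suc k)) (\<tau> \<circ> Transposition.transpose k (Suc k)) \<and>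
        (\<tau> \<circ> Transposition.transpose k (Suc k)) (Suc k) \<noteq> Suc k"
      using fixed by (auto simp: fibonacci_permutation_def)
  qed
  show "?L \<subseteq> ?R"
  proof clarify
    fix \<sigma> assume \<sigma>: "fibonacci_permutation (Suc (Suc k)) \<sigma>" and ne: "\<sigma> (Suc k) \<noteq> Suc k"
    have perm: "\<sigma> permutes {..<Suc (Suc k)}"
      and near: "\<And>i. i < Suc (Suc k) \<Longrightarrow> \<bar>int (\<sigma> i) - int i\<bar> \<le> 1"
      using \<sigma> by (auto simp: fibonacci_permutation_def)
    \<comment> \<open>The displacement bound alone would still allow the value
      \<open>Suc (Suc k)\<close>; the range excludes it.\<close>
    have "\<sigma> (Suc k) < Suc (Suc k)"
      using permutes_in_image[OF perm, of "Suc k"] by simp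
    then have 1: "\<sigma> (Suc k) = k"
      using near[of "Suc k"] ne by auto
    have "Suc k \<in> \<sigma> ` {..<Suc (Suc k)}"
      by (simp add: permutes_image[OF perm])
    then obtain j where j: "j < Suc (Suc k)" "\<sigma> j = Suc k"
      by auto
    moreover have "j \<noteq> Suc k"
      using j(2) ne by blast
    ultimately have "j = k"
      using near[of j] by auto
    with j have 2: "\<sigma> k = Suc k"
      by simp
    define \<tau> where "\<tau> = \<sigma> \<circ> Transposition.transpose k (Suc k)"
    have "\<tau> permutes {..<Suc (Suc k)}"
      unfolding \<tau>_def by (intro permutes_compose permutes_swap_id perm) auto
    moreover have "\<tau> k = k" "\<tau> (Suc k) = Suc k"
      using 1 2 by (simp_all add: \<tau>_def)
    then have "\<tau> i = i" if "i \<in> {..<Suc (Suc k)} - {..<k}" for i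
      using that by (metis Diff_iff lessThan_iff less_Suc_eq)
    ultimately have "\<tau> permutes {..<k}"
      by (rule permutes_superset)
    \<comment> \<open>Undoing the swap alters values only at \<open>k\<close> and
      \<open>Suc k\<close>, so the displacement bounds below \<open>k\<close> are inherited.\<close>
    moreover have "\<tau> i = \<sigma> i" if "i < k" for i
      using that by (simp add: \<tau>_def Transposition.transpose_def)
    ultimately have "fibonacci_permutation k \<tau>"
      using near by (simp add: fibonacci_permutation_def)
    moreover have "\<sigma> = \<tau> \<circ> Transposition.transpose k (Suc k)"
      by (simp add: \<tau>_def comp_assoc)
    ultimately show "\<sigma> \<in> ?R"
      by blast
  qed
qed

lemma finite_fibonacci_permutations: "finite {\<sigma>. fibonacci_permutation k \<sigma>}"
  by (rule finite_subset[OF _ finite_permutations[of "{..<k}"]])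
    (auto simp: fibonacci_permutation_def)

text \<open>Splitting by whether the last position is fixed gives the Fibonacci recurrence. The
  count is 1 for both \<open>k = 0\<close> and \<open>k = 1\<close>, hence the index
  \<open>Suc k\<close>.\<close>

lemma card_fibonacci_permutations: "card {\<sigma>. fibonacci_permutation k \<sigma>} = fib (Suc k)"
proof (induction k rule: fib.induct)
  case 1
  have "{\<sigma>. fibonacci_permutation 0 \<sigma>} = {id}"
    by (auto simp: fibonacci_permutation_def)
  then show ?case
    by simp
next
  case 2
  have "{\<sigma>. fibonacci_permutation (Suc 0) \<sigma>} = {id}"
    by (auto simp: fibonacci_permutation_def lessThan_Suc)
  then show ?case
    by simp
next
  case (3 k)
  let ?F = "\<lambda>k. {\<sigma>. fibonacci_permutation k \<sigma>}"
  let ?S = "(\<lambda>\<tau>. \<tau> \<circ> Transposition.transpose k (Suc k)) ` ?F k"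
  have "?F (Suc (Suc k)) = {\<sigma>. fibonacci_permutation (Suc (Suc k)) \<sigma> \<and> \<sigma> (Suc k) = Suc k} \<union>
      {\<sigma>. fibonacci_permutation (Suc (Suc k)) \<sigma> \<and> \<sigma> (Suc k) \<noteq> Suc k}"
    by blast
  also have "\<dots> = ?F (Suc k) \<union> ?S"
    by (simp only: fibonacci_permutation_Suc_fix_iff fibonacci_permutation_Suc_Suc_swap)
  finally have split: "?F (Suc (Suc k)) = ?F (Suc k) \<union> ?S" .
  have disj: "?F (Suc k) \<inter> ?S = {}"
    using fibonacci_permutation_Suc_Suc_swap[of k] fibonacci_permutation_Suc_fix_iff[of "Suc k"]
    by blast
  have "inj_on (\<lambda>\<tau>. \<tau> \<circ> Transposition.transpose k (Suc k)) (?F k)"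
    by (rule inj_on_inverseI[of _ "\<lambda>\<sigma>. \<sigma> \<circ> Transposition.transpose k (Suc k)"]) (simp add: comp_assoc)
  then have "card ?S = fib (Suc k)"
    using 3 by (simp add: card_image)
  then show ?case
    using 3 unfolding split
    by (subst card_Un_disjoint) (use disj in \<open>auto simp: finite_fibonacci_permutations\<close>)
qed

section \<open>Fibonacci ordered partitions\<close>

text \<open>Rearranging keeps the set of blocks, which determines the listing. As its blocks are
  distinct, the permutation can then be read off the positions; beyond the length both permutations
  are the identity.\<close>

lemma permute_list_partition_listing_inj:
  assumes l: "partition_listing n Bs" "partition_listing n Cs"
    and perm: "\<sigma> permutes {..<length Bs}" "\<tau> permutes {..<length Cs}"
    and eq: "permute_list \<sigma> Bs = permute_list \<tau> Cs"
  shows "Bs = Cs \<and> \<sigma> = \<tau>"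
proof
  have "set Bs = set Cs"
    using arg_cong[OF eq, of set] perm by simp
  then show "Bs = Cs"
    by (rule partition_listing_unique[OF l])
  show "\<sigma> = \<tau>"
  proof
    fix i
    show "\<sigma> i = \<tau> i"
    proof (cases "i < length Bs")
      case True
      then have "Bs ! \<sigma> i = Bs ! \<tau> i"
        using arg_cong[OF eq, of "\<lambda>xs. xs ! i"] \<open>Bs = Cs\<close> by (simp add: permute_list_def)
      moreover have "\<sigma> i < length Bs" "\<tau> i < length Bs"
        using True perm \<open>Bs = Cs\<close> permutes_in_image by fastforce+
      ultimately show ?thesis
        using partition_listing_distinct[OF l(1)] by (simp add: nth_eq_iff_index_eq)
    next
      case False
      then show ?thesis
        using perm \<open>Bs = Cs\<close> by (simp add: permutes_not_in)
    qed
  qed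
qed

lemma fibonacci_fubini_eq_sum_Stirling:
  "fibonacci_fubini n = (\<Sum>k\<le>n. Stirling n k * fib (Suc k))"
proof -
  \<comment> \<open>\<open>D k\<close> collects the Fibonacci ordered partitions with exactly
    \<open>k\<close> blocks.\<close>
  define D where
    "D k = (\<lambda>(\<sigma>, Bs). permute_list \<sigma> Bs) `
       ({\<sigma>. fibonacci_permutation k \<sigma>} \<times> partition_listings n k)" for k
  \<comment> \<open>For more than \<open>n\<close> blocks the Stirling number is zero, and a finite
    set of cardinality zero contains no listing.\<close>
  have length_le: "length Bs \<le> n" if "partition_listing n Bs" for Bs
  proof (rule ccontr)
    assume "\<not> length Bs \<le> n"
    then have "card (partition_listings n (length Bs)) = 0"
      by (simp add: card_partition_listings)
    then show False
      using that card_partition_listings[of n "length Bs"] by (auto simp: partition_listings_def)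
  qed
  have "fibonacci_ordered_partitions n = (\<Union>k\<le>n. D k)"
    using length_le
    by (fastforce simp: fibonacci_ordered_partitions_def D_def partition_listings_def)
  moreover have "card (\<Union>k\<le>n. D k) = (\<Sum>k\<le>n. card (D k))"
  proof (rule card_UN_disjoint)
    show "\<forall>k\<in>{..n}. finite (D k)"
      using card_partition_listings finite_fibonacci_permutations by (simp add: D_def)
    have "length Bs = k" if "Bs \<in> D k" for Bs k
      using that by (auto simp: D_def partition_listings_def)
    then show "\<forall>i\<in>{..n}. \<forall>j\<in>{..n}. i \<noteq> j \<longrightarrow> D i \<inter> D j = {}"
      by blast
  qed simp
  moreover have "card (D k) = Stirling n k * fib (Suc k)" for k
  proof -
    have "inj_on (\<lambda>(\<sigma>, Bs). permute_list \<sigma> Bs)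
        ({\<sigma>. fibonacci_permutation k \<sigma>} \<times> partition_listings n k)"
      using permute_list_partition_listing_inj
      by (fastforce intro!: inj_onI simp: partition_listings_def fibonacci_permutation_def)
    then show ?thesis
      by (simp add: D_def card_image card_cartesian_product card_partition_listings
          card_fibonacci_permutations)
  qed
  ultimately show ?thesis
    by (simp add: fibonacci_fubini_def)
qed

section \<open>The Dobinski series\<close>

text \<open>The Stirling recurrence is moved onto the weights: passing from row \<open>Suc n\<close>
  to row \<open>n\<close> replaces \<open>f j\<close> by \<open>j * f j + f (Suc j)\<close>.\<close>

lemma sum_Stirling_Suc:
  fixes f :: "nat \<Rightarrow> 'a::comm_semiring_1"
  shows "(\<Sum>j\<le>Suc n. of_nat (Stirling (Suc n) j) * f j) =
    (\<Sum>j\<le>n. of_nat (Stirling n j) * (of_nat j * f j + f (Suc j)))"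
proof -
  have "(\<Sum>j\<le>Suc n. of_nat (Stirling (Suc n) j) * f j) =
      (\<Sum>j\<le>n. of_nat (Suc j * Stirling n (Suc j)) * f (Suc j)) +
      (\<Sum>j\<le>n. of_nat (Stirling n j) * f (Suc j))"
    by (subst sum.atMost_Suc_shift) (simp add: sum.distrib algebra_simps)
  \<comment> \<open>The term at 0 that this shift adds vanishes through its factor \<open>j\<close>;
    the top term dropped next vanishes because \<open>Stirling n (Suc n) = 0\<close>.\<close>
  also have "(\<Sum>j\<le>n. of_nat (Suc j * Stirling n (Suc j)) * f (Suc j)) =
      (\<Sum>j\<le>Suc n. of_nat (j * Stirling n j) * f j)"
    by (subst sum.atMost_Suc_shift) simp
  also have "\<dots> = (\<Sum>j\<le>n. of_nat (j * Stirling n j) * f j)"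
    by simp
  finally show ?thesis
    by (simp add: sum.distrib algebra_simps)
qed

text \<open>The weight \<open>fact j * (k choose j)\<close> is the falling factorial
  k(k-1)...(k-j+1). Writing k = j + (k - j), multiplication by k gives j times this factorial plus
  the next one, as \<open>sum_Stirling_Suc\<close> requires.\<close>

lemma power_eq_sum_Stirling_binomial:
  "real k ^ n = (\<Sum>j\<le>n. real (Stirling n j) * (fact j * real (k choose j)))"
proof (induction n)
  case 0
  \<comment> \<open>For \<open>k = 0\<close> this uses \<open>0 ^ 0 = 1\<close>.\<close>
  then show ?case
    by simp
next
  case (Suc n)
  have "real k * (fact j * real (k choose j)) =
      real j * (fact j * real (k choose j)) + fact (Suc j) * real (k choose Suc j)" for j
  proof -
    \<comment> \<open>The difference is taken in the reals and may be negative, but for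
      \<open>j > k\<close> both binomial coefficients are zero.\<close>
    have "real (Suc j * (k choose Suc j)) = (real k - real j) * real (k choose j)"
    proof (cases "j \<le> k")
      case True
      have "Suc j * (k choose Suc j) = (k - j) * (k choose j)"
        using binomial_absorption[of j "k"] binomial_absorb_comp[of k j]
        by (cases k) auto
      then show ?thesis
        using True by (metis of_nat_diff of_nat_mult)
    qed (simp add: binomial_eq_0)
    then have "real k * real (k choose j) = real j * real (k choose j) + real (Suc j * (k choose Suc j))"
      by (simp add: left_diff_distrib)
    then have "fact j * (real k * real (k choose j)) =
        fact j * (real j * real (k choose j) + real (Suc j * (k choose Suc j)))"
      by (rule arg_cong)
    then show ?thesis
      by (simp add: algebra_simps)
  qed
  then have "real k * (\<Sum>j\<le>n. real (Stirling n j) * (fact j * real (k choose j))) =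
      (\<Sum>j\<le>n. real (Stirling n j) *
        (real j * (fact j * real (k choose j)) + fact (Suc j) * real (k choose Suc j)))"
    unfolding sum_distrib_left by (intro sum.cong refl) (metis mult.left_commute)
  then show ?case
    using Suc by (subst sum_Stirling_Suc) simp
qed

text \<open>Terms with \<open>k < j\<close> vanish. From index \<open>j\<close> on, the factorials
  cancel and leave \<open>x ^ j\<close> times the exponential series.\<close>

lemma binomial_exp_series_sums:
  fixes x :: real
  shows "(\<lambda>k. x ^ k * (fact j * real (k choose j)) / fact k) sums (x ^ j * exp x)"
proof -
  have "(\<lambda>m. x ^ j * (x ^ m /\<^sub>R fact m)) sums (x ^ j * exp x)"
    by (intro sums_mult exp_converges)
  moreover have "x ^ (m + j) * (fact j * real ((m + j) choose j)) / fact (m + j) =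
      x ^ j * (x ^ m /\<^sub>R fact m)" for m
    by (simp add: binomial_fact power_add field_simps)
  ultimately have "(\<lambda>m. x ^ (m + j) * (fact j * real ((m + j) choose j)) / fact (m + j)) sums
      (x ^ j * exp x)"
    by simp
  then show ?thesis
    by (subst (asm) sums_zero_iff_shift) simp_all
qed

text \<open>The finite expansion of \<open>k ^ n\<close> is summed termwise. For
  \<open>x = 1\<close> this is Dobinski's formula for the Bell numbers.\<close>

lemma dobinski_series_sums:
  fixes x :: real
  shows "(\<lambda>k. x ^ k * real k ^ n / fact k) sums (exp x * (\<Sum>j\<le>n. real (Stirling n j) * x ^ j))"
proof -
  have "(\<lambda>k. \<Sum>j\<le>n. real (Stirling n j) * (x ^ k * (fact j * real (k choose j)) / fact k)) sums
      (\<Sum>j\<le>n. real (Stirling n j) * (x ^ j * exp x))"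
    by (intro sums_sum sums_mult binomial_exp_series_sums)
  then show ?thesis
    by (simp add: power_eq_sum_Stirling_binomial sum_distrib_left sum_divide_distrib mult_ac)
qed

theorem theorem5:
  fixes n :: nat
  shows "real (fibonacci_fubini n) =
    1 / sqrt 5 *
      (fib_alpha / exp fib_alpha * (\<Sum>k. fib_alpha ^ k * real k ^ n / fact k)
       - fib_beta / exp fib_beta * (\<Sum>k. fib_beta ^ k * real k ^ n / fact k))"
proof -
  \<comment> \<open>The prefactor cancels \<open>exp x\<close> and its numerator raises the exponent
    to \<open>Suc j\<close>, the index that Binet's formula needs for
    \<open>fib (Suc j)\<close>.\<close>
  have series: "x / exp x * (\<Sum>k. x ^ k * real k ^ n / fact k) =
      (\<Sum>j\<le>n. real (Stirling n j) * x ^ Suc j)" for x :: real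
    by (simp add: sums_unique[OF dobinski_series_sums, symmetric] sum_distrib_left mult_ac)
  have "real (fibonacci_fubini n) =
      (\<Sum>j\<le>n. real (Stirling n j) * ((fib_alpha ^ Suc j - fib_beta ^ Suc j) / sqrt 5))"
    unfolding fibonacci_fubini_eq_sum_Stirling fib_alpha_def fib_beta_def
    by (simp only: of_nat_sum of_nat_mult fib_closed_form)
  also have "\<dots> = 1 / sqrt 5 * ((\<Sum>j\<le>n. real (Stirling n j) * fib_alpha ^ Suc j)
      - (\<Sum>j\<le>n. real (Stirling n j) * fib_beta ^ Suc j))"
    unfolding sum_subtractf[symmetric] sum_distrib_left
    by (intro sum.cong refl) (simp only: right_diff_distrib diff_divide_distrib times_divide_eq_right mult_1_left
        times_divide_eq_left)
  finally show ?thesis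
    by (simp only: series)
qed

end
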